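(* Let $n\ge 2$. There exists a family of zero mean curvature hypersurfaces in Lorentz-Minkowski space $\mathbb{R}^{n+1}_1$ which change type across an $(n-1)$-dimensional light-like plane.
   Context: $\mathbb{R}^{n+1}_1$ is Lorentz-Minkowski space with coordinates $(t,x_1,\dots,x_n)$ and metric $-dt^2+dx_1^2+\cdots+dx_n^2$. A hypersurface that is the graph $t=F(x_1,\dots,x_n)$ of a smooth function $F$ on an open subset of $\mathbb{R}^n$ is a zero mean curvature hypersurface if $$\Bigl(1-\sum_{j=1}^n F_{x_j}^2\Bigr)\sum_{i=1}^n F_{x_ix_i}+\sum_{i,j=1}^n F_{x_ix_j}F_{x_i}F_{x_j}=0,$$ subscripts denoting partial derivatives. The graph is space-like where $1-\sum_j F_{x_j}^2>0$ and time-like where $1-\sum_j F_{x_j}^2<0$. An $(n-1)$-dimensional light-like plane is (an open piece of) an $(n-1)$-dimensional affine subspace of $\mathbb{R}^{n+1}_1$ on which the induced metric is degenerate. The hypersurface changes type across such a plane if it contains it and $1-\sum_j F_{x_j}^2$ changes sign across it, the hypersurface being space-like on one side and time-like on the other. *)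

theory Defs
  imports "HOL-Analysis.Analysis"
begin

text \<open>Lorentz-Minkowski space of dimension $n+1$ is \<^typ>\<open>real \<times> (real ^ 'n)\<close> with
  $n = $ \<^term>\<open>CARD('n)\<close>; the first component is the time coordinate $t$.\<close>

definition lorentz :: "real \<times> (real ^ 'n) \<Rightarrow> real \<times> (real ^ 'n) \<Rightarrow> real" where
  "lorentz p q = - (fst p * fst q) + snd p \<bullet> snd q"

definition partial :: "'n \<Rightarrow> (real ^ 'n \<Rightarrow> real) \<Rightarrow> real ^ 'n \<Rightarrow> real" where
  "partial i F x = frechet_derivative F (at x) (axis i 1)"

text \<open>Class $C^k$ on a set that is meant to be open: \<^const>\<open>partial\<close> is only ever
  evaluated at points of differentiability.\<close>

primrec Ck_on :: "nat \<Rightarrow> (real ^ 'n) set \<Rightarrow> (real ^ 'n \<Rightarrow> real) \<Rightarrow> bool" where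
  "Ck_on 0 U F \<longleftrightarrow> continuous_on U F"
| "Ck_on (Suc k) U F \<longleftrightarrow> (\<forall>x\<in>U. F differentiable (at x)) \<and> (\<forall>i. Ck_on k U (partial i F))"

definition smooth_on :: "(real ^ 'n) set \<Rightarrow> (real ^ 'n \<Rightarrow> real) \<Rightarrow> bool" where
  "smooth_on U F \<longleftrightarrow> (\<forall>k. Ck_on k U F)"

definition graph_over :: "(real ^ 'n) set \<Rightarrow> (real ^ 'n \<Rightarrow> real) \<Rightarrow> (real \<times> (real ^ 'n)) set" where
  "graph_over U F = (\<lambda>x. (F x, x)) ` U"

definition causal_fn :: "(real ^ 'n \<Rightarrow> real) \<Rightarrow> real ^ 'n \<Rightarrow> real" where
  "causal_fn F x = 1 - (\<Sum>j\<in>UNIV. (partial j F x)\<^sup>2)"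

definition space_like_at :: "(real ^ 'n \<Rightarrow> real) \<Rightarrow> real ^ 'n \<Rightarrow> bool" where
  "space_like_at F x \<longleftrightarrow> causal_fn F x > 0"

definition time_like_at :: "(real ^ 'n \<Rightarrow> real) \<Rightarrow> real ^ 'n \<Rightarrow> bool" where
  "time_like_at F x \<longleftrightarrow> causal_fn F x < 0"

definition zmc_graph :: "(real ^ 'n) set \<Rightarrow> (real ^ 'n \<Rightarrow> real) \<Rightarrow> bool" where
  "zmc_graph U F \<longleftrightarrow> open U \<and> smooth_on U F \<and>
     (\<forall>x\<in>U. (1 - (\<Sum>j\<in>UNIV. (partial j F x)\<^sup>2)) * (\<Sum>i\<in>UNIV. partial i (partial i F) x)
        + (\<Sum>i\<in>UNIV. \<Sum>j\<in>UNIV. partial j (partial i F) x * partial i F x * partial j F x) = 0)"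

definition light_like_plane :: "(real \<times> (real ^ 'n)) set \<Rightarrow> bool" where
  "light_like_plane P \<longleftrightarrow> affine P \<and> aff_dim P = int CARD('n) - 1 \<and>
     (\<exists>v \<in> {p - q | p q. p \<in> P \<and> q \<in> P}. v \<noteq> 0 \<and>
        (\<forall>w \<in> {p - q | p q. p \<in> P \<and> q \<in> P}. lorentz v w = 0))"

definition light_like_plane_piece :: "(real \<times> (real ^ 'n)) set \<Rightarrow> bool" where
  "light_like_plane_piece S \<longleftrightarrow>
     S \<noteq> {} \<and> (\<exists>P. light_like_plane P \<and> openin (top_of_set P) S)"

text \<open>A light-like plane contains no vertical direction, so the projection \<^term>\<open>snd ` S\<close> of a
  piece \<open>S\<close> to the domain is an open piece of a unique affine hyperplane $a \cdot x = b$; its two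
  sides are the sides of \<open>S\<close> in the graph. The choice of sign of $(a, b)$ decides which side is the
  space-like one.\<close>

definition changes_type_across ::
  "(real ^ 'n) set \<Rightarrow> (real ^ 'n \<Rightarrow> real) \<Rightarrow> (real \<times> (real ^ 'n)) set \<Rightarrow> bool" where
  "changes_type_across U F S \<longleftrightarrow>
     S \<subseteq> graph_over U F \<and>
     (\<exists>a b V. a \<noteq> 0 \<and> snd ` S \<subseteq> {x. a \<bullet> x = b} \<and>
        open V \<and> snd ` S \<subseteq> V \<and> V \<subseteq> U \<and>
        (\<forall>x\<in>V. a \<bullet> x > b \<longrightarrow> space_like_at F x) \<and>
        (\<forall>x\<in>V. a \<bullet> x < b \<longrightarrow> time_like_at F x))"

text \<open>Two graphs through \<open>S\<close> are identified if they agree near \<open>S\<close>, so that shrinking the domain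
  does not produce a new hypersurface.\<close>

definition same_near ::
  "(real \<times> (real ^ 'n)) set \<Rightarrow> (real ^ 'n) set \<Rightarrow> (real ^ 'n \<Rightarrow> real)
     \<Rightarrow> (real ^ 'n) set \<Rightarrow> (real ^ 'n \<Rightarrow> real) \<Rightarrow> bool" where
  "same_near S U F U' F' \<longleftrightarrow>
     (\<exists>V. open V \<and> snd ` S \<subseteq> V \<and> V \<subseteq> U \<inter> U' \<and> (\<forall>x\<in>V. F x = F' x))"

end

theory Submission
  imports Defs
begin

text \<open>
  Write $x$ and $y$ for two of the coordinates and use the null coordinates $u = t - y$ and
  $v = t + y$.  A hypersurface $u = G(x, v)$ that does not depend on the other coordinates has zero
  mean curvature if and only if $G_{vv} = G_{xx} G_v - G_x G_{xv}$.  The light cone $u v = x^2$,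
  that is $G = x^2 / v$, is a solution, and it is light-like everywhere.  Inserting the ansatz
  $G = A(x) + x^2 / v$ leaves the single condition $x A'' = 2 A'$, so the cone may be bent by a
  cubic: for every real $\kappa$ the hypersurface
  \[ (t - y - 2 \kappa x^3) (t + y) = x^2 \]
  has zero mean curvature.  It still contains the light-like plane $x = 0$, $t = y$.

  The equation is quadratic in $t$, so the sheet through this plane over the half space $y > 0$ is
  the explicit graph $t = \kappa x^3 + r$ with $r^2 = (y + \kappa x^3)^2 + x^2$; this is
  \<open>bent_cone\<close>.  Its causal function factors (\<open>causal_fn_bent_cone\<close>) as
  \[ 1 - F_x^2 - F_y^2 = - 3 \kappa x^3 \, w \, (2 + 3 \kappa x w) / r^2,
     \qquad w = r + y + \kappa x^3, \]
  where $w > 0$ off the plane and the last bracket is close to $2$ near it.  The sign is thus that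
  of $- \kappa x$, and the type changes across $x = 0$.  Different values of $\kappa$ give graphs
  that differ at every point with $x \neq 0$, because the defining equation determines $\kappa$
  there.

  What remains is calculus: closure of the $C^k$ classes under the operations that build the graph
  (up to \<open>Ck_on_sqrt\<close>), the reduction of the zero mean curvature equation to two variables
  (\<open>zmc_graph_two_coordinates\<close>), and its verification for this graph
  (\<open>zmc_graph_bent_cone\<close>).
\<close>

section \<open>Calculus of partial derivatives\<close>

lemma partial_eq:
  assumes "(F has_derivative D) (at x)"
  shows "partial k F x = D (axis k 1)"
  using frechet_derivative_at[OF assms] by (simp add: partial_def)

text \<open>The Frechet derivative is a choice among all derivatives at the point; as the set of these
  is determined by the germ of the function, so is the choice.\<close>

lemma partial_cong:
  assumes "open U" "x \<in> U" "\<And>y. y \<in> U \<Longrightarrow> F y = G y"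
  shows "partial k F x = partial k G x"
proof -
  have "(F has_derivative D) (at x) \<longleftrightarrow> (G has_derivative D) (at x)" for D
    by (intro iffI; erule has_derivative_transform_within_open[OF _ assms(1,2)])
      (simp_all add: assms(3))
  then show ?thesis by (simp add: partial_def frechet_derivative_def)
qed

lemma Ck_on_SucD:
  assumes "Ck_on (Suc k) U F"
  shows "x \<in> U \<Longrightarrow> F differentiable (at x)" and "Ck_on k U (partial m F)"
  using assms by simp_all

lemma Ck_on_Suc_has_derivative:
  assumes "Ck_on (Suc k) U F" "x \<in> U"
  shows "(F has_derivative frechet_derivative F (at x)) (at x)"
  using Ck_on_SucD(1)[OF assms] frechet_derivative_works by blast

lemma Ck_on_cong:
  assumes "open U" "\<And>x. x \<in> U \<Longrightarrow> F x = G x" "Ck_on k U F"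
  shows "Ck_on k U G"
  using assms(2,3)
proof (induction k arbitrary: F G)
  case 0
  then have "continuous_on U F" by (simp only: Ck_on.simps)
  then have "continuous_on U G" by (rule continuous_on_eq) (rule "0.prems")
  then show ?case by (simp only: Ck_on.simps)
next
  case (Suc k)
  have "G differentiable (at x)" if "x \<in> U" for x
  proof -
    have "(G has_derivative frechet_derivative F (at x)) (at x)"
      by (rule has_derivative_transform_within_open[OF
            Ck_on_Suc_has_derivative[OF Suc.prems(2) that] assms(1) that Suc.prems(1)])
    then show ?thesis by (rule differentiableI)
  qed
  moreover have "Ck_on k U (partial m G)" for m
  proof (rule Suc.IH)
    show "partial m F x = partial m G x" if "x \<in> U" for x
      by (rule partial_cong[OF assms(1) that Suc.prems(1)])
    show "Ck_on k U (partial m F)" by (rule Ck_on_SucD(2)[OF Suc.prems(2)])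
  qed
  ultimately show ?case by (simp only: Ck_on.simps) simp
qed

lemma Ck_on_Suc_imp: "Ck_on (Suc k) U F \<Longrightarrow> Ck_on k U F"
proof (induction k arbitrary: F)
  case 0
  then show ?case
    by (auto intro!: differentiable_imp_continuous_on differentiable_at_imp_differentiable_on)
next
  case (Suc k)
  have "Ck_on k U (partial m F)" for m
    by (rule Suc.IH[OF Ck_on_SucD(2)[OF Suc.prems]])
  then show ?case
    using Ck_on_SucD(1)[OF Suc.prems] by (simp only: Ck_on.simps) simp
qed

text \<open>Closure of the classes under an operation is proved from the derivative \<open>D\<close> that the
  calculus rules produce. It equals the partial derivatives only on \<open>U\<close>, which suffices because
  \<open>U\<close> is open.\<close>

lemma Ck_on_SucI:
  assumes "open U"
    and "\<And>x. x \<in> U \<Longrightarrow> (F has_derivative D x) (at x)"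
    and "\<And>m. Ck_on k U (\<lambda>x. D x (axis m 1))"
  shows "Ck_on (Suc k) U F"
proof -
  have "Ck_on k U (partial m F)" for m
    by (rule Ck_on_cong[OF assms(1) _ assms(3)[of m]]) (simp add: partial_eq[OF assms(2)])
  then show ?thesis using assms(2) by (auto simp: differentiable_def)
qed

lemma Ck_on_const: "open U \<Longrightarrow> Ck_on k U (\<lambda>x. c)"
proof (induction k arbitrary: c)
  case (Suc k)
  show ?case
    by (rule Ck_on_SucI[where D = "\<lambda>_ _. 0"]) (use Suc in auto)
qed simp

lemma has_derivative_nth [derivative_intros]:
  "((\<lambda>x. x $ i) has_derivative (\<lambda>h. h $ i)) (at (x :: real ^ 'n))"
  by (intro bounded_linear_imp_has_derivative bounded_linear_vec_nth)

lemma Ck_on_nth: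
  assumes "open U"
  shows "Ck_on k U (\<lambda>x. x $ i)"
proof (cases k)
  case 0
  then show ?thesis by (simp add: continuous_on_component)
next
  case (Suc l)
  show ?thesis
    unfolding Suc
    by (intro Ck_on_SucI[OF assms has_derivative_nth] Ck_on_const assms)
qed

lemma Ck_on_Suc_partial:
  assumes "Ck_on (Suc k) U F"
  shows "Ck_on k U (\<lambda>x. frechet_derivative F (at x) (axis m 1))"
  using assms by (simp add: partial_def[abs_def])

lemma Ck_on_add:
  assumes "open U"
  shows "Ck_on k U F \<Longrightarrow> Ck_on k U G \<Longrightarrow> Ck_on k U (\<lambda>x. F x + G x)"
proof (induction k arbitrary: F G)
  case 0
  then show ?case by (simp add: continuous_on_add)
next
  case (Suc k)
  have "Ck_on k U (\<lambda>x. frechet_derivative F (at x) (axis m 1)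
      + frechet_derivative G (at x) (axis m 1))" for m
    by (intro Suc.IH Ck_on_Suc_partial Suc.prems)
  then show ?case
    by (intro Ck_on_SucI[OF assms has_derivative_add[OF
            Ck_on_Suc_has_derivative[OF Suc.prems(1)] Ck_on_Suc_has_derivative[OF Suc.prems(2)]]])
qed

lemma Ck_on_mult:
  assumes "open U"
  shows "Ck_on k U F \<Longrightarrow> Ck_on k U G \<Longrightarrow> Ck_on k U (\<lambda>x. F x * G x)"
proof (induction k arbitrary: F G)
  case 0
  then show ?case by (simp add: continuous_on_mult)
next
  case (Suc k)
  have "Ck_on k U (\<lambda>x. F x * frechet_derivative G (at x) (axis m 1)
      + frechet_derivative F (at x) (axis m 1) * G x)" for m
    by (intro Ck_on_add assms Suc.IH Ck_on_Suc_partial Suc.prems Ck_on_Suc_imp[OF Suc.prems(1)]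
        Ck_on_Suc_imp[OF Suc.prems(2)])
  then show ?case
    by (intro Ck_on_SucI[OF assms has_derivative_mult[OF
            Ck_on_Suc_has_derivative[OF Suc.prems(1)] Ck_on_Suc_has_derivative[OF Suc.prems(2)]]])
qed

text \<open>Here and for the square root the derivative contains the function itself, one class lower,
  which is where the induction hypothesis enters.\<close>

lemma Ck_on_inverse:
  assumes "open U" "\<And>x. x \<in> U \<Longrightarrow> F x \<noteq> 0"
  shows "Ck_on k U F \<Longrightarrow> Ck_on k U (\<lambda>x. inverse (F x))"
proof (induction k)
  case 0
  then show ?case using assms(2) by (simp add: continuous_on_inverse)
next
  case (Suc k)
  note inv = Suc.IH[OF Ck_on_Suc_imp[OF Suc.prems]]
  have "Ck_on k U (\<lambda>x. (- 1) * (inverse (F x) * frechet_derivative F (at x) (axis m 1)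
      * inverse (F x)))" for m
    by (intro Ck_on_mult Ck_on_const assms(1) inv Ck_on_Suc_partial[OF Suc.prems])
  then show ?case
    by (intro Ck_on_SucI[OF assms(1) Deriv.has_derivative_inverse[OF assms(2)
            Ck_on_Suc_has_derivative[OF Suc.prems]]]) auto
qed

lemma Ck_on_sqrt:
  assumes "open U" "\<And>x. x \<in> U \<Longrightarrow> 0 < F x"
  shows "Ck_on k U F \<Longrightarrow> Ck_on k U (\<lambda>x. sqrt (F x))"
proof (induction k)
  case 0
  then show ?case by (simp add: continuous_on_real_sqrt)
next
  case (Suc k)
  have "Ck_on k U (\<lambda>x. inverse (sqrt (F x)))"
    by (rule Ck_on_inverse[OF assms(1) _ Suc.IH[OF Ck_on_Suc_imp[OF Suc.prems]]])
      (use assms(2) in force)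
  then have "Ck_on k U (\<lambda>x. frechet_derivative F (at x) (axis m 1)
      * (inverse (sqrt (F x)) * (1 / 2)))" for m
    by (intro Ck_on_mult Ck_on_const assms(1) Ck_on_Suc_partial[OF Suc.prems])
  moreover have "((\<lambda>x. sqrt (F x)) has_derivative
      (\<lambda>h. frechet_derivative F (at x) h * (inverse (sqrt (F x)) * (1 / 2)))) (at x)"
    if "x \<in> U" for x
    by (rule has_derivative_eq_rhs[OF has_derivative_real_sqrt[OF assms(2)[OF that]
            Ck_on_Suc_has_derivative[OF Suc.prems that]]]) (auto simp: field_simps)
  ultimately show ?case
    by (intro Ck_on_SucI[OF assms(1)])
qed

section \<open>Graphs that depend on two coordinates\<close>

lemma partial_two_coordinates:
  fixes F :: "real ^ 'n \<Rightarrow> real"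
  assumes "(F has_derivative (\<lambda>h. A * h $ i + B * h $ j)) (at x)" "i \<noteq> j"
  shows "partial k F x = (if k = i then A else if k = j then B else 0)"
  using partial_eq[OF assms(1), of k] assms(2) by (auto simp: axis_def)

lemma sum_two_indices:
  fixes g :: "'n::finite \<Rightarrow> real"
  assumes "i \<noteq> j" "\<And>k. k \<noteq> i \<Longrightarrow> k \<noteq> j \<Longrightarrow> g k = 0"
  shows "(\<Sum>k\<in>UNIV. g k) = g i + g j"
proof -
  have "(\<Sum>k\<in>UNIV. g k) = (\<Sum>k\<in>{i, j}. g k)"
    using assms(2) by (intro sum.mono_neutral_right) auto
  then show ?thesis using assms(1) by simp
qed

lemma causal_fn_two_coordinates:
  assumes "(F has_derivative (\<lambda>h. A * h $ i + B * h $ j)) (at x)" "i \<noteq> j"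
  shows "causal_fn F x = 1 - (A\<^sup>2 + B\<^sup>2)"
  unfolding causal_fn_def partial_two_coordinates[OF assms]
  by (subst sum_two_indices[OF assms(2)]) (use assms(2) in auto)

text \<open>Locally the graph is the product of a surface in three-dimensional Lorentz-Minkowski
  space with a flat space-like factor of dimension $n - 2$, so the equation is that of the surface.
  Taking the same \<open>Q\<close> for both mixed derivatives encodes their symmetry.\<close>

lemma zmc_graph_two_coordinates:
  fixes F :: "real ^ 'n \<Rightarrow> real"
  assumes U: "open U" "smooth_on U F" and ij: "i \<noteq> j"
    and F: "\<And>x. x \<in> U \<Longrightarrow> (F has_derivative (\<lambda>h. A x * h $ i + B x * h $ j)) (at x)"
    and A: "\<And>x. x \<in> U \<Longrightarrow> (A has_derivative (\<lambda>h. P x * h $ i + Q x * h $ j)) (at x)"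
    and B: "\<And>x. x \<in> U \<Longrightarrow> (B has_derivative (\<lambda>h. Q x * h $ i + R x * h $ j)) (at x)"
    and eq: "\<And>x. x \<in> U \<Longrightarrow>
      (1 - (B x)\<^sup>2) * P x + 2 * A x * B x * Q x + (1 - (A x)\<^sup>2) * R x = 0"
  shows "zmc_graph U F"
  unfolding zmc_graph_def
proof (intro conjI ballI U)
  fix x assume x: "x \<in> U"
  have p: "partial k F y = (if k = i then A y else if k = j then B y else 0)" if "y \<in> U" for k y
    using partial_two_coordinates[OF F[OF that] ij] .
  have pi: "partial k (partial i F) x = (if k = i then P x else if k = j then Q x else 0)" for k
    using partial_cong[OF U(1) x, of "partial i F" A k] p
      partial_two_coordinates[OF A[OF x] ij] by auto
  have pj: "partial k (partial j F) x = (if k = i then Q x else if k = j then R x else 0)" for k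
    using partial_cong[OF U(1) x, of "partial j F" B k] p ij
      partial_two_coordinates[OF B[OF x] ij] by auto
  have p0: "partial k (partial l F) x = 0" if "l \<noteq> i" "l \<noteq> j" for k l
    using partial_cong[OF U(1) x, of "partial l F" "\<lambda>_. 0" k] p that
      partial_eq[OF has_derivative_const[of 0 "at x"], of k] by auto
  have grad: "(\<Sum>k\<in>UNIV. (partial k F x)\<^sup>2) = (A x)\<^sup>2 + (B x)\<^sup>2"
    by (subst sum_two_indices[OF ij]) (use ij p[OF x] in auto)
  have lap: "(\<Sum>k\<in>UNIV. partial k (partial k F) x) = P x + R x"
    by (subst sum_two_indices[OF ij]) (use ij pi pj p0 in auto)
  have inner: "(\<Sum>l\<in>UNIV. partial l (partial k F) x * partial k F x * partial l F x)
      = partial i (partial k F) x * partial k F x * A x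
        + partial j (partial k F) x * partial k F x * B x" for k
    by (subst sum_two_indices[OF ij]) (use ij p[OF x] in auto)
  have hess: "(\<Sum>k\<in>UNIV. \<Sum>l\<in>UNIV. partial l (partial k F) x * partial k F x * partial l F x)
      = P x * (A x)\<^sup>2 + 2 * Q x * A x * B x + R x * (B x)\<^sup>2"
    unfolding inner
    by (subst sum_two_indices[OF ij])
      (use ij p[OF x] pi pj in \<open>auto simp: power2_eq_square algebra_simps\<close>)
  show "(1 - (\<Sum>k\<in>UNIV. (partial k F x)\<^sup>2)) * (\<Sum>k\<in>UNIV. partial k (partial k F) x)
      + (\<Sum>k\<in>UNIV. \<Sum>l\<in>UNIV. partial l (partial k F) x * partial k F x * partial l F x) = 0"
    unfolding grad lap hess using eq[OF x] by (simp add: algebra_simps)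
qed

section \<open>The bent light cone\<close>

text \<open>In the following, \<open>i\<close> is the index of the coordinate called $x$ above and \<open>j\<close> that of $y$.\<close>

definition bent_cone_radius :: "'n \<Rightarrow> 'n \<Rightarrow> real \<Rightarrow> real ^ 'n \<Rightarrow> real" where
  "bent_cone_radius i j \<kappa> x = sqrt ((x $ j + \<kappa> * (x $ i) ^ 3)\<^sup>2 + (x $ i)\<^sup>2)"

definition bent_cone :: "'n \<Rightarrow> 'n \<Rightarrow> real \<Rightarrow> real ^ 'n \<Rightarrow> real" where
  "bent_cone i j \<kappa> x = \<kappa> * (x $ i) ^ 3 + bent_cone_radius i j \<kappa> x"

definition bent_cone_dx :: "'n \<Rightarrow> 'n \<Rightarrow> real \<Rightarrow> real ^ 'n \<Rightarrow> real" where
  "bent_cone_dx i j \<kappa> x = 3 * \<kappa> * (x $ i)\<^sup>2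
     + (3 * \<kappa> * (x $ i)\<^sup>2 * (x $ j + \<kappa> * (x $ i) ^ 3) + x $ i) / bent_cone_radius i j \<kappa> x"

definition bent_cone_dy :: "'n \<Rightarrow> 'n \<Rightarrow> real \<Rightarrow> real ^ 'n \<Rightarrow> real" where
  "bent_cone_dy i j \<kappa> x = (x $ j + \<kappa> * (x $ i) ^ 3) / bent_cone_radius i j \<kappa> x"

lemma bent_cone_radius_pos:
  assumes "0 < x $ j"
  shows "0 < bent_cone_radius i j \<kappa> x"
proof -
  have "0 < (x $ j + \<kappa> * (x $ i) ^ 3)\<^sup>2 + (x $ i)\<^sup>2"
    using assms by (cases "x $ i = 0") (auto intro: add_nonneg_pos)
  then show ?thesis by (simp add: bent_cone_radius_def)
qed

lemma bent_cone_radius_square: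
  "(bent_cone_radius i j \<kappa> x)\<^sup>2 = (x $ j + \<kappa> * (x $ i) ^ 3)\<^sup>2 + (x $ i)\<^sup>2"
  by (simp add: bent_cone_radius_def)

text \<open>This makes the factor $w$ of the causal function positive off the light-like plane.\<close>

lemma bent_cone_radius_greater:
  assumes "x $ i \<noteq> 0"
  shows "\<bar>x $ j + \<kappa> * (x $ i) ^ 3\<bar> < bent_cone_radius i j \<kappa> x"
  unfolding bent_cone_radius_def by (rule real_less_rsqrt) (use assms in simp)

lemma open_half_space_nth: "open {x :: real ^ 'n. 0 < x $ j}"
  by (intro open_Collect_less continuous_intros)

lemma smooth_on_bent_cone: "smooth_on {x. 0 < x $ j} (bent_cone i j \<kappa>)"
  unfolding smooth_on_def
proof
  fix k
  let ?U = "{x :: real ^ 'a. 0 < x $ j}"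
  have cube: "Ck_on k ?U (\<lambda>x. \<kappa> * (x $ i) ^ 3)"
    unfolding power3_eq_cube
    by (intro Ck_on_mult Ck_on_const Ck_on_nth open_half_space_nth)
  have "Ck_on k ?U (\<lambda>x. (x $ j + \<kappa> * (x $ i) ^ 3)\<^sup>2 + (x $ i)\<^sup>2)"
    unfolding power2_eq_square
    by (intro Ck_on_add Ck_on_mult Ck_on_nth cube open_half_space_nth)
  then have "Ck_on k ?U (\<lambda>x. sqrt ((x $ j + \<kappa> * (x $ i) ^ 3)\<^sup>2 + (x $ i)\<^sup>2))"
    using bent_cone_radius_pos[of _ j i \<kappa>]
    by (intro Ck_on_sqrt open_half_space_nth) (auto simp: bent_cone_radius_def)
  then show "Ck_on k ?U (bent_cone i j \<kappa>)"
    unfolding bent_cone_def bent_cone_radius_def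
    by (intro Ck_on_add cube open_half_space_nth)
qed

lemma has_derivative_bent_cone_radius:
  fixes x :: "real ^ 'n"
  assumes "0 < x $ j"
  shows "(bent_cone_radius i j \<kappa> has_derivative
     (\<lambda>h. (3 * \<kappa> * (x $ i)\<^sup>2 * (x $ j + \<kappa> * (x $ i) ^ 3) + x $ i) / bent_cone_radius i j \<kappa> x * h $ i
        + bent_cone_dy i j \<kappa> x * h $ j)) (at x)"
proof -
  define a where "a = 3 * \<kappa> * (x $ i)\<^sup>2"
  define Y where "Y = x $ j + \<kappa> * (x $ i) ^ 3"
  define r where "r = bent_cone_radius i j \<kappa> x"
  have r: "r = sqrt ((x $ j + \<kappa> * (x $ i) ^ 3)\<^sup>2 + (x $ i)\<^sup>2)" "0 < r"
    using bent_cone_radius_pos[OF assms, of i \<kappa>] by (simp_all add: r_def bent_cone_radius_def)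
  have "((\<lambda>x. (x $ j + \<kappa> * (x $ i) ^ 3)\<^sup>2 + (x $ i)\<^sup>2) has_derivative
      (\<lambda>h. 2 * (a * Y + x $ i) * h $ i + 2 * Y * h $ j)) (at x)"
    by (auto intro!: derivative_eq_intros simp: a_def Y_def fun_eq_iff algebra_simps)
  from has_derivative_real_sqrt[OF _ this] r
  have "(bent_cone_radius i j \<kappa> has_derivative
      (\<lambda>h. (2 * (a * Y + x $ i) * h $ i + 2 * Y * h $ j) * (inverse r / 2))) (at x)"
    by (simp add: bent_cone_radius_def[abs_def])
  also have "(\<lambda>h. (2 * (a * Y + x $ i) * h $ i + 2 * Y * h $ j) * (inverse r / 2))
      = (\<lambda>h. (a * Y + x $ i) / r * h $ i + Y / r * h $ j)"
    using r(2) by (simp add: fun_eq_iff field_simps)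
  finally show ?thesis by (simp add: bent_cone_dy_def a_def Y_def r_def)
qed

lemma has_derivative_bent_cone:
  fixes x :: "real ^ 'n"
  assumes "0 < x $ j"
  shows "(bent_cone i j \<kappa> has_derivative
     (\<lambda>h. bent_cone_dx i j \<kappa> x * h $ i + bent_cone_dy i j \<kappa> x * h $ j)) (at x)"
  unfolding bent_cone_def[abs_def] bent_cone_dx_def
  by (auto intro!: derivative_eq_intros has_derivative_bent_cone_radius[OF assms]
      simp: fun_eq_iff algebra_simps)

text \<open>The second derivatives are written in terms of $Y = y + \kappa x^3$ and its $x$-derivatives
  $a$ and $b$, since the zero mean curvature equation only uses the relations
  $r^2 = Y^2 + x^2$ and $b x = 2 a$ between them.\<close>

definition bent_cone_dxx :: "'n \<Rightarrow> 'n \<Rightarrow> real \<Rightarrow> real ^ 'n \<Rightarrow> real" where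
  "bent_cone_dxx i j \<kappa> x =
     (let a = 3 * \<kappa> * (x $ i)\<^sup>2; b = 6 * \<kappa> * x $ i; Y = x $ j + \<kappa> * (x $ i) ^ 3;
        r = bent_cone_radius i j \<kappa> x
      in b + (b * Y + a\<^sup>2 + 1) / r - (a * Y + x $ i)\<^sup>2 / r ^ 3)"

definition bent_cone_dxy :: "'n \<Rightarrow> 'n \<Rightarrow> real \<Rightarrow> real ^ 'n \<Rightarrow> real" where
  "bent_cone_dxy i j \<kappa> x =
     (let a = 3 * \<kappa> * (x $ i)\<^sup>2; Y = x $ j + \<kappa> * (x $ i) ^ 3; r = bent_cone_radius i j \<kappa> x
      in a / r - Y * (a * Y + x $ i) / r ^ 3)"

definition bent_cone_dyy :: "'n \<Rightarrow> 'n \<Rightarrow> real \<Rightarrow> real ^ 'n \<Rightarrow> real" where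
  "bent_cone_dyy i j \<kappa> x =
     (let Y = x $ j + \<kappa> * (x $ i) ^ 3; r = bent_cone_radius i j \<kappa> x in 1 / r - Y\<^sup>2 / r ^ 3)"

lemma has_derivative_two_coordinates_divide:
  fixes f g :: "real ^ 'n \<Rightarrow> real"
  assumes "(f has_derivative (\<lambda>h. a * h $ i + b * h $ j)) (at x)"
    and "(g has_derivative (\<lambda>h. c * h $ i + d * h $ j)) (at x)" and "g x \<noteq> 0"
  shows "((\<lambda>x. f x / g x) has_derivative
    (\<lambda>h. (a / g x - f x * c / (g x)\<^sup>2) * h $ i + (b / g x - f x * d / (g x)\<^sup>2) * h $ j)) (at x)"
  by (rule has_derivative_eq_rhs[OF has_derivative_divide'[OF assms]])
    (use assms(3) in \<open>auto simp: fun_eq_iff field_simps power2_eq_square\<close>)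

lemma has_derivative_bent_cone_dx:
  fixes x :: "real ^ 'n"
  assumes "0 < x $ j"
  shows "(bent_cone_dx i j \<kappa> has_derivative
     (\<lambda>h. bent_cone_dxx i j \<kappa> x * h $ i + bent_cone_dxy i j \<kappa> x * h $ j)) (at x)"
proof -
  define a where "a = 3 * \<kappa> * (x $ i)\<^sup>2"
  define b where "b = 6 * \<kappa> * x $ i"
  define Y where "Y = x $ j + \<kappa> * (x $ i) ^ 3"
  define r where "r = bent_cone_radius i j \<kappa> x"
  have "((\<lambda>x. 3 * \<kappa> * (x $ i)\<^sup>2 * (x $ j + \<kappa> * (x $ i) ^ 3) + x $ i) has_derivative
      (\<lambda>h. (b * Y + a\<^sup>2 + 1) * h $ i + a * h $ j)) (at x)"
    by (auto intro!: derivative_eq_intros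
        simp: a_def b_def Y_def fun_eq_iff algebra_simps power2_eq_square power3_eq_cube)
  from has_derivative_two_coordinates_divide[OF this has_derivative_bent_cone_radius[OF assms]]
  have quotient: "((\<lambda>x. (3 * \<kappa> * (x $ i)\<^sup>2 * (x $ j + \<kappa> * (x $ i) ^ 3) + x $ i)
        / bent_cone_radius i j \<kappa> x) has_derivative
      (\<lambda>h. ((b * Y + a\<^sup>2 + 1) / r - (a * Y + x $ i) * ((a * Y + x $ i) / r) / r\<^sup>2) * h $ i
        + (a / r - (a * Y + x $ i) * (Y / r) / r\<^sup>2) * h $ j)) (at x)"
    using bent_cone_radius_pos[OF assms, of i \<kappa>]
    by (simp add: a_def Y_def r_def bent_cone_dy_def)
  have square: "((\<lambda>x. 3 * \<kappa> * (x $ i)\<^sup>2) has_derivative (\<lambda>h. b * h $ i)) (at x)"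
    by (auto intro!: derivative_eq_intros simp: b_def fun_eq_iff)
  have coeffs: "bent_cone_dxx i j \<kappa> x
      = b + ((b * Y + a\<^sup>2 + 1) / r - (a * Y + x $ i) * ((a * Y + x $ i) / r) / r\<^sup>2)"
    "bent_cone_dxy i j \<kappa> x = a / r - (a * Y + x $ i) * (Y / r) / r\<^sup>2"
    by (simp_all add: bent_cone_dxx_def bent_cone_dxy_def Let_def a_def b_def Y_def r_def
        power2_eq_square power3_eq_cube mult_ac)
  show ?thesis
    unfolding bent_cone_dx_def[abs_def]
    by (rule has_derivative_eq_rhs[OF has_derivative_add[OF square quotient]])
      (simp only: coeffs fun_eq_iff distrib_right add.assoc simp_thms)
qed

lemma has_derivative_bent_cone_dy:
  fixes x :: "real ^ 'n"
  assumes "0 < x $ j"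
  shows "(bent_cone_dy i j \<kappa> has_derivative
     (\<lambda>h. bent_cone_dxy i j \<kappa> x * h $ i + bent_cone_dyy i j \<kappa> x * h $ j)) (at x)"
proof -
  define a where "a = 3 * \<kappa> * (x $ i)\<^sup>2"
  define Y where "Y = x $ j + \<kappa> * (x $ i) ^ 3"
  define r where "r = bent_cone_radius i j \<kappa> x"
  have "((\<lambda>x. x $ j + \<kappa> * (x $ i) ^ 3) has_derivative (\<lambda>h. a * h $ i + 1 * h $ j)) (at x)"
    by (auto intro!: derivative_eq_intros simp: a_def fun_eq_iff)
  from has_derivative_two_coordinates_divide[OF this has_derivative_bent_cone_radius[OF assms]]
  have "(bent_cone_dy i j \<kappa> has_derivative
      (\<lambda>h. (a / r - Y * ((a * Y + x $ i) / r) / r\<^sup>2) * h $ i + (1 / r - Y * (Y / r) / r\<^sup>2) * h $ j)) (at x)"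
    using bent_cone_radius_pos[OF assms, of i \<kappa>]
    unfolding bent_cone_dy_def[abs_def]
    by (simp add: a_def Y_def r_def)
  moreover have "bent_cone_dxy i j \<kappa> x = a / r - Y * ((a * Y + x $ i) / r) / r\<^sup>2"
    "bent_cone_dyy i j \<kappa> x = 1 / r - Y * (Y / r) / r\<^sup>2"
    by (simp_all add: bent_cone_dyy_def bent_cone_dxy_def Let_def a_def Y_def r_def
        power2_eq_square power3_eq_cube mult_ac)
  ultimately show ?thesis by simp
qed

text \<open>The relation $b s = 2 a$ for $a = p'(s)$ and $b = p''(s)$ says that the bending profile $p$ is
  a multiple of $s^3$ up to a constant: it is the condition that singles out the cubic.\<close>

lemma bent_cone_zmc_identity:
  fixes s a b Y r :: real
  assumes r: "r\<^sup>2 = Y\<^sup>2 + s\<^sup>2" "r \<noteq> 0" and ab: "b * s = 2 * a"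
  shows "(1 - (Y / r)\<^sup>2) * (b + (b * Y + a\<^sup>2 + 1) / r - (a * Y + s)\<^sup>2 / r ^ 3)
     + 2 * (a + (a * Y + s) / r) * (Y / r) * (a / r - Y * (a * Y + s) / r ^ 3)
     + (1 - (a + (a * Y + s) / r)\<^sup>2) * (1 / r - Y\<^sup>2 / r ^ 3) = 0"
proof -
  \<comment> \<open>In terms of \<open>q\<close> the claim is a membership in the polynomial ideal generated by
    \<open>q\<^sup>2 * (Y\<^sup>2 + s\<^sup>2) - 1\<close> and \<open>b * s - 2 * a\<close>.\<close>
  define q where "q = 1 / r"
  have q: "q\<^sup>2 * (Y\<^sup>2 + s\<^sup>2) = 1" using r by (simp add: q_def power_divide flip: r(1))
  have "(1 - (Y * q)\<^sup>2) * (b + (b * Y + a\<^sup>2 + 1) * q - (a * Y + s)\<^sup>2 * q ^ 3)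
     + 2 * (a + (a * Y + s) * q) * (Y * q) * (a * q - Y * (a * Y + s) * q ^ 3)
     + (1 - (a + (a * Y + s) * q)\<^sup>2) * (q - Y\<^sup>2 * q ^ 3) = 0"
    using q ab by algebra
  then show ?thesis by (simp add: q_def divide_inverse power_inverse)
qed

lemma zmc_graph_bent_cone:
  assumes "i \<noteq> j"
  shows "zmc_graph {x. 0 < x $ j} (bent_cone i j \<kappa>)"
proof (rule zmc_graph_two_coordinates[OF open_half_space_nth smooth_on_bent_cone assms
      has_derivative_bent_cone has_derivative_bent_cone_dx has_derivative_bent_cone_dy])
  fix x :: "real ^ 'a"
  assume "x \<in> {x. 0 < x $ j}"
  then have "bent_cone_radius i j \<kappa> x \<noteq> 0"
    using bent_cone_radius_pos[of x j i \<kappa>] by simp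
  then show "(1 - (bent_cone_dy i j \<kappa> x)\<^sup>2) * bent_cone_dxx i j \<kappa> x
      + 2 * bent_cone_dx i j \<kappa> x * bent_cone_dy i j \<kappa> x * bent_cone_dxy i j \<kappa> x
      + (1 - (bent_cone_dx i j \<kappa> x)\<^sup>2) * bent_cone_dyy i j \<kappa> x = 0"
    unfolding bent_cone_dx_def bent_cone_dy_def bent_cone_dxx_def bent_cone_dxy_def
      bent_cone_dyy_def Let_def
    by (intro bent_cone_zmc_identity bent_cone_radius_square) (simp_all add: power2_eq_square)
qed simp_all

text \<open>Substituting $r^2 - Y^2 = x^2$ cancels the terms of order $x^2$, the only ones present for
  $\kappa = 0$; the remaining leading term has the odd order $x^3$ and therefore changes
  sign.\<close>

lemma causal_fn_bent_cone:
  fixes x :: "real ^ 'n" and i j :: 'n and \<kappa> :: real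
  assumes "i \<noteq> j" "0 < x $ j"
  defines "w \<equiv> bent_cone_radius i j \<kappa> x + (x $ j + \<kappa> * (x $ i) ^ 3)"
  shows "causal_fn (bent_cone i j \<kappa>) x =
    - (3 * \<kappa> * (x $ i) ^ 3 * w * (3 * \<kappa> * x $ i * w + 2)) / (bent_cone_radius i j \<kappa> x)\<^sup>2"
proof -
  define r where "r = bent_cone_radius i j \<kappa> x"
  define Y where "Y = x $ j + \<kappa> * (x $ i) ^ 3"
  have r: "0 < r" "r\<^sup>2 = Y\<^sup>2 + (x $ i)\<^sup>2"
    using bent_cone_radius_pos[OF assms(2)] bent_cone_radius_square
    by (auto simp: r_def Y_def)
  have "causal_fn (bent_cone i j \<kappa>) x
      = 1 - ((3 * \<kappa> * (x $ i)\<^sup>2 + (3 * \<kappa> * (x $ i)\<^sup>2 * Y + x $ i) / r)\<^sup>2 + (Y / r)\<^sup>2)"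
    unfolding causal_fn_two_coordinates[OF has_derivative_bent_cone[OF assms(2)] assms(1)]
      bent_cone_dx_def bent_cone_dy_def r_def Y_def ..
  also have "\<dots> = (r\<^sup>2 - (3 * \<kappa> * (x $ i)\<^sup>2 * (r + Y) + x $ i)\<^sup>2 - Y\<^sup>2) / r\<^sup>2"
    using r(1) by (simp add: field_simps power2_eq_square)
  also have "\<dots> = - (3 * \<kappa> * (x $ i) ^ 3 * (r + Y) * (3 * \<kappa> * x $ i * (r + Y) + 2)) / r\<^sup>2"
    unfolding r(2) by (simp add: algebra_simps power2_eq_square power3_eq_cube)
  finally show ?thesis by (simp add: w_def r_def Y_def)
qed

lemma bent_cone_equation:
  "(bent_cone i j \<kappa> x - x $ j - 2 * \<kappa> * (x $ i) ^ 3) * (bent_cone i j \<kappa> x + x $ j) = (x $ i)\<^sup>2"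
  using bent_cone_radius_square[of i j \<kappa> x]
  by (simp add: bent_cone_def power2_eq_square algebra_simps)

lemma bent_cone_inj:
  assumes "x $ i \<noteq> 0" "bent_cone i j \<kappa> x = bent_cone i j \<kappa>' x"
  shows "\<kappa> = \<kappa>'"
proof -
  define t where "t = bent_cone i j \<kappa> x"
  have e: "(t - x $ j - 2 * \<kappa> * (x $ i) ^ 3) * (t + x $ j) = (x $ i)\<^sup>2"
    "(t - x $ j - 2 * \<kappa>' * (x $ i) ^ 3) * (t + x $ j) = (x $ i)\<^sup>2"
    using bent_cone_equation[of i j \<kappa> x] bent_cone_equation[of i j \<kappa>' x] assms(2)
    by (auto simp: t_def)
  then have "t + x $ j \<noteq> 0" using assms(1) by auto
  moreover have "(\<kappa> - \<kappa>') * (x $ i) ^ 3 * (t + x $ j) = 0"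
    using e by (simp add: algebra_simps)
  ultimately show ?thesis using assms(1) by simp
qed

section \<open>The light-like plane\<close>

definition null_plane :: "'n \<Rightarrow> 'n \<Rightarrow> (real \<times> (real ^ 'n)) set" where
  "null_plane i j = {p. fst p = snd p $ j \<and> snd p $ i = 0}"

text \<open>Only the half with $y > 0$ lies on the graph: over $y < 0$ the bent cone meets $x = 0$ in
  $t = - y$.\<close>

definition null_half_plane :: "'n \<Rightarrow> 'n \<Rightarrow> (real \<times> (real ^ 'n)) set" where
  "null_half_plane i j = {p \<in> null_plane i j. 0 < snd p $ j}"

lemma null_plane_eq_image:
  "null_plane i j = (\<lambda>x. (x $ j, x)) ` {x. axis i 1 \<bullet> x = 0}"
  by (force simp: null_plane_def inner_axis')

lemma light_like_plane_null_plane: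
  fixes i j :: "'n::finite"
  assumes "i \<noteq> j"
  shows "light_like_plane (null_plane i j)"
  unfolding light_like_plane_def
proof (intro conjI)
  have lin: "linear (\<lambda>x::real^'n. (x $ j, x))"
    by (auto intro!: linearI)
  have inj: "inj (\<lambda>x::real^'n. (x $ j, x))" by (auto intro!: injI)
  show "affine (null_plane i j)"
    by (auto simp: affine_def null_plane_def algebra_simps)
  show "aff_dim (null_plane i j) = int CARD('n) - 1"
    unfolding null_plane_eq_image aff_dim_injective_linear_image[OF lin inj]
    by (subst aff_dim_hyperplane) (auto simp: axis_eq_0_iff)
  \<comment> \<open>The null direction of the plane is that of increasing \<open>t + y\<close> at fixed \<open>t - y\<close>.\<close>
  let ?v = "(1, axis j 1) :: real \<times> (real ^ 'n)"
  have "?v = ?v - 0" "?v \<in> null_plane i j" "0 \<in> null_plane i j"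
    using assms by (auto simp: null_plane_def axis_def)
  then have "?v \<in> {p - q | p q. p \<in> null_plane i j \<and> q \<in> null_plane i j}" by blast
  moreover have "?v \<noteq> 0" by (simp add: zero_prod_def)
  moreover have "lorentz ?v w = 0"
    if "w \<in> {p - q | p q. p \<in> null_plane i j \<and> q \<in> null_plane i j}" for w
    using that by (auto simp: lorentz_def null_plane_def inner_axis')
  ultimately show "\<exists>v\<in>{p - q | p q. p \<in> null_plane i j \<and> q \<in> null_plane i j}. v \<noteq> 0 \<and>
      (\<forall>w\<in>{p - q | p q. p \<in> null_plane i j \<and> q \<in> null_plane i j}. lorentz v w = 0)"
    by blast
qed

lemma light_like_plane_piece_null_half_plane:
  fixes i j :: "'n::finite"
  assumes "i \<noteq> j"
  shows "light_like_plane_piece (null_half_plane i j)"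
  unfolding light_like_plane_piece_def
proof (intro conjI exI)
  have "(1, axis j 1) \<in> null_half_plane i j"
    using assms by (auto simp: null_half_plane_def null_plane_def axis_def)
  then show "null_half_plane i j \<noteq> {}" by blast
  have "open {p :: real \<times> (real ^ 'n). 0 < snd p $ j}"
    by (intro open_Collect_less continuous_intros)
  moreover have "null_half_plane i j = null_plane i j \<inter> {p. 0 < snd p $ j}"
    by (auto simp: null_half_plane_def)
  ultimately show "openin (top_of_set (null_plane i j)) (null_half_plane i j)"
    by (auto simp: openin_open)
qed (rule light_like_plane_null_plane[OF assms])

lemma changes_type_across_bent_cone:
  fixes i j :: "'n::finite"
  assumes ij: "i \<noteq> j" and \<kappa>: "0 < \<kappa>"
  shows "changes_type_across {x. 0 < x $ j} (bent_cone i j \<kappa>) (null_half_plane i j)"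
  unfolding changes_type_across_def
proof (intro conjI exI)
  have "p = (bent_cone i j \<kappa> (snd p), snd p)" if "p \<in> null_half_plane i j" for p
    using that by (auto simp: null_half_plane_def null_plane_def bent_cone_def
        bent_cone_radius_def prod_eq_iff)
  then show "null_half_plane i j \<subseteq> graph_over {x. 0 < x $ j} (bent_cone i j \<kappa>)"
    by (auto simp: graph_over_def null_half_plane_def image_iff)
  let ?w = "\<lambda>x. bent_cone_radius i j \<kappa> x + (x $ j + \<kappa> * (x $ i) ^ 3)"
  \<comment> \<open>The second condition keeps the last factor of the causal function positive; on the plane it
    reads \<open>0 < 2\<close>.\<close>
  let ?V = "{x. 0 < x $ j} \<inter> {x. 0 < 3 * \<kappa> * x $ i * ?w x + 2}"
  \<comment> \<open>The minus sign: the space-like side is that of negative \<open>x $ i\<close>.\<close>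
  show "- axis i 1 \<noteq> (0 :: real ^ 'n)" by (simp add: axis_eq_0_iff)
  show "snd ` null_half_plane i j \<subseteq> {x. (- axis i 1) \<bullet> x = 0}"
    by (auto simp: null_half_plane_def null_plane_def inner_axis')
  show "open ?V"
    unfolding bent_cone_radius_def
    by (intro open_Int open_half_space_nth open_Collect_less continuous_intros)
  show "snd ` null_half_plane i j \<subseteq> ?V"
    by (auto simp: null_half_plane_def null_plane_def)
  show "?V \<subseteq> {x. 0 < x $ j}" by blast
  have w: "0 < ?w x" if "x $ i \<noteq> 0" for x
    using bent_cone_radius_greater[OF that, of j \<kappa>] by linarith
  have sgn: "0 < 3 * \<kappa> * ?w x * (3 * \<kappa> * x $ i * ?w x + 2) / (bent_cone_radius i j \<kappa> x)\<^sup>2"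
    (is "0 < ?m x")
    if "x \<in> ?V" "x $ i \<noteq> 0" for x
    using that w[OF that(2)] \<kappa> bent_cone_radius_pos[of x j i \<kappa>] by simp
  have causal: "causal_fn (bent_cone i j \<kappa>) x = - ((x $ i) ^ 3 * ?m x)" if "x \<in> ?V" for x
    using causal_fn_bent_cone[OF ij, of x \<kappa>] that by (simp add: mult_ac)
  show "\<forall>x\<in>?V. (- axis i 1) \<bullet> x > 0 \<longrightarrow> space_like_at (bent_cone i j \<kappa>) x"
  proof (intro ballI impI)
    fix x assume x: "x \<in> ?V" "(- axis i 1) \<bullet> x > 0"
    then have "x $ i < 0" by (simp add: inner_axis')
    then have "(x $ i) ^ 3 < 0" "0 < ?m x" using sgn[OF x(1)] by auto
    then show "space_like_at (bent_cone i j \<kappa>) x"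
      unfolding space_like_at_def causal[OF x(1)] using mult_neg_pos neg_0_less_iff_less by blast
  qed
  show "\<forall>x\<in>?V. (- axis i 1) \<bullet> x < 0 \<longrightarrow> time_like_at (bent_cone i j \<kappa>) x"
  proof (intro ballI impI)
    fix x assume x: "x \<in> ?V" "(- axis i 1) \<bullet> x < 0"
    then have "x $ i > 0" by (simp add: inner_axis')
    then have "(x $ i) ^ 3 > 0" "0 < ?m x" using sgn[OF x(1)] by auto
    then show "time_like_at (bent_cone i j \<kappa>) x"
      unfolding time_like_at_def causal[OF x(1)] using mult_pos_pos neg_less_0_iff_less by blast
  qed
qed

lemma not_same_near_bent_cone:
  fixes i j :: "'n::finite"
  assumes ij: "i \<noteq> j" and "\<kappa> \<noteq> \<kappa>'"
  shows "\<not> same_near (null_half_plane i j) U (bent_cone i j \<kappa>) U' (bent_cone i j \<kappa>')"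
proof
  assume "same_near (null_half_plane i j) U (bent_cone i j \<kappa>) U' (bent_cone i j \<kappa>')"
  then obtain V where V: "open V" "snd ` null_half_plane i j \<subseteq> V"
    and eq: "\<And>x. x \<in> V \<Longrightarrow> bent_cone i j \<kappa> x = bent_cone i j \<kappa>' x"
    by (auto simp: same_near_def)
  have "(1, axis j 1) \<in> null_half_plane i j"
    using ij by (auto simp: null_half_plane_def null_plane_def axis_def)
  then have "axis j 1 \<in> V" using V(2) by force
  then obtain e where e: "0 < e" "ball (axis j 1) e \<subseteq> V"
    using V(1) open_contains_ball by blast
  define x :: "real ^ 'n" where "x = axis j 1 + (e / 2) *\<^sub>R axis i 1"
  have "x \<in> V" using e by (auto simp: x_def dist_norm subset_iff)
  moreover have "x $ i \<noteq> 0" using e ij by (auto simp: x_def axis_def)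
  ultimately show False using bent_cone_inj eq assms(2) by blast
qed

theorem corollary1p2:
  assumes "CARD('n::finite) \<ge> 2"
  shows "\<exists>(S :: (real \<times> (real ^ 'n)) set) (U :: real \<Rightarrow> (real ^ 'n) set)
            (F :: real \<Rightarrow> real ^ 'n \<Rightarrow> real).
    light_like_plane_piece S \<and>
    (\<forall>c. zmc_graph (U c) (F c) \<and> changes_type_across (U c) (F c) S) \<and>
    (\<forall>c d. c \<noteq> d \<longrightarrow> \<not> same_near S (U c) (F c) (U d) (F d))"
proof -
  obtain i j :: 'n where ij: "i \<noteq> j"
    using assms card_le_Suc0_iff_eq[of "UNIV :: 'n set"] by (auto simp: not_less_eq_eq[symmetric])
  \<comment> \<open>The exponential keeps the bending parameter positive for every real index.\<close>
  have "\<not> same_near (null_half_plane i j) {x. 0 < x $ j} (bent_cone i j (exp c))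
      {x. 0 < x $ j} (bent_cone i j (exp d))" if "c \<noteq> d" for c d :: real
    using that by (intro not_same_near_bent_cone ij) simp
  then show ?thesis
    by (intro exI[of _ "null_half_plane i j"] exI[of _ "\<lambda>_. {x. 0 < x $ j}"]
        exI[of _ "\<lambda>c. bent_cone i j (exp c)"] conjI allI impI
        light_like_plane_piece_null_half_plane zmc_graph_bent_cone
        changes_type_across_bent_cone ij exp_gt_zero)
qed

end
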